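(* Let $A, B, C, X \in \mathbb{R}^{n\times n}$. If $A$ is nonsingular, then the T-congruence Sylvester equation $AX + X^{\mathrm T}B = C$ can be transformed into the Lyapunov equation of the form $$\tilde X - M\tilde X M^{\mathrm T} = Q,$$ where $\tilde X := AX$, $M := B^{\mathrm T}A^{-1}$, and $Q := C - \mathrm{vec}^{-1}\bigl(P_{nn}\,\mathrm{vec}(MC)\bigr)$.
   Context: In the T-congruence Sylvester equation $AX + X^{\mathrm T}B = C$ the matrices $A,B,C$ are given and $X$ is to be determined; $X^{\mathrm T}$ denotes the transpose of $X$. For a matrix $Y\in\mathbb{R}^{n\times n}$ with columns $y_1,\dots,y_n$, $\mathrm{vec}(Y)\in\mathbb{R}^{n^2}$ is the vector obtained by stacking $y_1,\dots,y_n$ on top of each other in this order, and $\mathrm{vec}^{-1}:\mathbb{R}^{n^2}\to\mathbb{R}^{n\times n}$ is the inverse operator, so $\mathrm{vec}^{-1}(\mathrm{vec}(Y))=Y$. Let $e_{in}\in\mathbb{R}^n$ be the column vector with $1$ in position $i$ and $0$ elsewhere, $I_n$ the $n\times n$ identity matrix, and $\otimes$ the Kronecker (tensor) product. $P_{nn}\in\mathbb{R}^{n^2\times n^2}$ is the permutation matrix obtained by stacking vertically the blocks $I_n\otimes e_{1n}^{\mathrm T},\ I_n\otimes e_{2n}^{\mathrm T},\dots,\ I_n\otimes e_{nn}^{\mathrm T}$ in this order. *)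

theory Defs
  imports
    "Jordan_Normal_Form.Gauss_Jordan_Elimination"
begin

text \<open>Indices of matrices and vectors start at 0.\<close>

definition vec_mat :: "'a mat \<Rightarrow> 'a vec" where
  "vec_mat Y = vec_of_list (concat (map list_of_vec (cols Y)))"

text \<open>Only meaningful on vectors of dimension \<^term>\<open>n * n\<close>: there it inverts the bijection
  \<^const>\<open>vec_mat\<close> from n by n matrices.\<close>

definition vec_mat_inv :: "nat \<Rightarrow> 'a vec \<Rightarrow> 'a mat" where
  "vec_mat_inv n = inv_into (carrier_mat n n) vec_mat"

definition kronecker :: "'a :: times mat \<Rightarrow> 'a mat \<Rightarrow> 'a mat" (infixl \<open>\<otimes>\<^sub>K\<close> 70) where
  "A \<otimes>\<^sub>K B = mat (dim_row A * dim_row B) (dim_col A * dim_col B)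
     (\<lambda>(i, j). A $$ (i div dim_row B, j div dim_col B) * B $$ (i mod dim_row B, j mod dim_col B))"

text \<open>The blocks \<open>I\<^sub>n \<otimes> e\<^sub>i\<^sub>n\<^sup>T\<close>, of size n by n * n, stacked from top to bottom.\<close>

definition perm_P :: "nat \<Rightarrow> real mat" where
  "perm_P n = foldr (@\<^sub>r) (map (\<lambda>i. 1\<^sub>m n \<otimes>\<^sub>K mat_of_row (unit_vec n i)) [0..<n]) (0\<^sub>m 0 (n * n))"

text \<open>The value is unspecified for singular matrices, where \<^const>\<open>mat_inverse\<close> returns
  \<^term>\<open>None\<close>.\<close>

definition matinv :: "'a :: field mat \<Rightarrow> 'a mat" where
  "matinv A = the (mat_inverse A)"

end

theory Submission
  imports Defs
begin

text \<open>The matrix \<open>P\<close> implements transposition on vectorised matrices, so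
  \<open>Q = C - (M * C)\<^sup>T\<close>. Transposing \<open>M * C = B\<^sup>T * X + M * X\<^sup>T * B\<close> yields
  \<open>(M * C)\<^sup>T = X\<^sup>T * B + M * (A * X) * M\<^sup>T\<close>, because \<open>B\<^sup>T * X = M * (A * X)\<close> and
  \<open>B = A\<^sup>T * M\<^sup>T\<close>; the terms \<open>X\<^sup>T * B\<close> cancel in \<open>Q\<close>.\<close>

lemma length_concat_uniform:
  assumes "\<And>xs. xs \<in> set xss \<Longrightarrow> length xs = m"
  shows "length (concat xss) = length xss * m"
  using assms by (induction xss) auto

lemma nth_concat_uniform:
  assumes "\<And>xs. xs \<in> set xss \<Longrightarrow> length xs = m" and "c < length xss" and "r < m"
  shows "concat xss ! (c * m + r) = xss ! c ! r"
  using assms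
proof (induction xss arbitrary: c)
  case (Cons xs xss)
  then show ?case by (cases c) (auto simp: nth_append)
qed simp

lemma dim_vec_mat:
  assumes "Y \<in> carrier_mat m n"
  shows "dim_vec (vec_mat Y) = n * m"
proof -
  have "length (concat (map list_of_vec (cols Y))) = length (map list_of_vec (cols Y)) * m"
    by (rule length_concat_uniform) (use assms in \<open>auto simp: cols_def\<close>)
  then show ?thesis using assms by (simp add: vec_mat_def)
qed

text \<open>Column \<open>c\<close> is preceded by \<open>c\<close> full columns of length
  \<open>m\<close>, hence the column-major offset \<open>c * m + r\<close>.\<close>

lemma index_vec_mat:
  assumes "Y \<in> carrier_mat m n" "r < m" "c < n"
  shows "vec_mat Y $ (c * m + r) = Y $$ (r, c)"
proof -
  have "concat (map list_of_vec (cols Y)) ! (c * m + r) = map list_of_vec (cols Y) ! c ! r"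
    by (rule nth_concat_uniform) (use assms in \<open>auto simp: cols_def\<close>)
  then show ?thesis using assms by (simp add: vec_mat_def vec_of_list_index list_of_vec_index)
qed

lemma inj_on_vec_mat: "inj_on vec_mat (carrier_mat m n)"
proof (rule inj_onI)
  fix Y Z :: "'a mat"
  assume Y: "Y \<in> carrier_mat m n" and Z: "Z \<in> carrier_mat m n" and eq: "vec_mat Y = vec_mat Z"
  show "Y = Z"
  proof (rule eq_matI)
    fix r c assume "r < dim_row Z" "c < dim_col Z"
    then have "r < m" "c < n" using Z by auto
    then show "Y $$ (r, c) = Z $$ (r, c)"
      using index_vec_mat[OF Y] index_vec_mat[OF Z] eq by metis
  qed (use Y Z in auto)
qed

lemma vec_mat_inv_vec_mat:
  assumes "Y \<in> carrier_mat n n"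
  shows "vec_mat_inv n (vec_mat Y) = Y"
  unfolding vec_mat_inv_def using inj_on_vec_mat assms by (rule inv_into_f_f)

text \<open>Each block multiplies the vector separately and the results are stacked. The carrier
  claim is part of the induction because splitting off the first block requires the dimensions of
  the remaining stack.\<close>

lemma foldr_append_rows_mult_vec:
  fixes v :: "'a :: comm_semiring_1 vec"
  assumes "\<And>A. A \<in> set As \<Longrightarrow> A \<in> carrier_mat m k" and "v \<in> carrier_vec k"
  shows "foldr (@\<^sub>r) As (0\<^sub>m 0 k) \<in> carrier_mat (length As * m) k
    \<and> foldr (@\<^sub>r) As (0\<^sub>m 0 k) *\<^sub>v v = vec_of_list (concat (map (\<lambda>A. list_of_vec (A *\<^sub>v v)) As))"
  using assms
proof (induction As)
  case Nil
  then show ?case by auto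
next
  case (Cons A As)
  let ?F = "foldr (@\<^sub>r) As (0\<^sub>m 0 k)"
  have A: "A \<in> carrier_mat m k" and F: "?F \<in> carrier_mat (length As * m) k"
    using Cons by auto
  have "(A @\<^sub>r ?F) *\<^sub>v v = (A *\<^sub>v v) @\<^sub>v (?F *\<^sub>v v)"
    using A F Cons.prems(2) by (rule mat_mult_append)
  \<comment> \<open>Turns stacking of vectors into appending of lists, so that \<open>concat\<close>
    can absorb the new block.\<close>
  moreover have "v @\<^sub>v vec_of_list xs = vec_of_list (list_of_vec v @ xs)"
    for v :: "'a vec" and xs
    by (metis list_of_vec_append list_vec vec_list)
  ultimately show ?case
    using Cons carrier_append_rows[OF A F] by simp
qed

text \<open>Row \<open>k\<close> of the block has its only 1 in column \<open>k * m + i\<close>,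
  exactly where \<open>vec_mat Y\<close> stores \<open>Y $$ (i, k)\<close>; the block thus picks out
  row \<open>i\<close>.\<close>

lemma kronecker_unit_row_mult_vec_mat:
  fixes Y :: "'a :: semiring_1 mat"
  assumes Y: "Y \<in> carrier_mat m n" and i: "i < m"
  shows "(1\<^sub>m n \<otimes>\<^sub>K mat_of_row (unit_vec m i)) *\<^sub>v vec_mat Y = row Y i"
proof (rule eq_vecI)
  fix k assume "k < dim_vec (row Y i)"
  then have k: "k < n" using Y by simp
  let ?K = "1\<^sub>m n \<otimes>\<^sub>K mat_of_row (unit_vec m i) :: 'a mat"
  have lt: "k * m + i < n * m"
  proof -
    have "k * m + i < Suc k * m" using i by simp
    also have "\<dots> \<le> n * m" using k by (intro mult_le_mono1) simp
    finally show ?thesis .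
  qed
  have entry: "?K $$ (k, j) = (if j = k * m + i then 1 else 0)" if j: "j < n * m" for j
  proof -
    have "j div m < n" using j by (simp add: less_mult_imp_div_less)
    moreover have "j mod m < m" using i by simp
    \<comment> \<open>Uniqueness of division with remainder, using \<open>i < m\<close>. The two
      conditions on the right are those under which the identity factor and the unit-vector factor
      are both 1.\<close>
    moreover have "j = k * m + i \<longleftrightarrow> k = j div m \<and> j mod m = i"
      using i by auto
    ultimately show ?thesis
      using j k by (auto simp: kronecker_def mat_of_row_def unit_vec_def)
  qed
  have "(?K *\<^sub>v vec_mat Y) $ k = (\<Sum>j = 0..<n * m. ?K $$ (k, j) * vec_mat Y $ j)"
    using k dim_vec_mat[OF Y] by (simp add: scalar_prod_def kronecker_def)
  also have "\<dots> = (\<Sum>j = 0..<n * m. if j = k * m + i then vec_mat Y $ j else 0)"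
    by (rule sum.cong) (auto simp: entry)
  \<comment> \<open>By \<open>lt\<close> the single surviving index lies in the range of
    summation.\<close>
  also have "\<dots> = vec_mat Y $ (k * m + i)" using lt by simp
  also have "\<dots> = row Y i $ k" using index_vec_mat[OF Y i k] Y i k by simp
  finally show "(?K *\<^sub>v vec_mat Y) $ k = row Y i $ k" .
qed (use Y in \<open>simp add: kronecker_def\<close>)

text \<open>The blocks produce the rows of \<open>Y\<close> one after another, and these are the
  columns of its transpose.\<close>

lemma perm_P_mult_vec_mat:
  assumes Y: "Y \<in> carrier_mat n n"
  shows "perm_P n *\<^sub>v vec_mat Y = vec_mat (Y\<^sup>T)"
proof -
  let ?As = "map (\<lambda>i. 1\<^sub>m n \<otimes>\<^sub>K mat_of_row (unit_vec n i)) [0..<n] :: real mat list"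
  have carr: "A \<in> carrier_mat n (n * n)" if "A \<in> set ?As" for A
    using that by (auto simp: kronecker_def)
  have v: "vec_mat Y \<in> carrier_vec (n * n)"
    using dim_vec_mat[OF Y] by (rule carrier_vecI)
  have "perm_P n *\<^sub>v vec_mat Y = vec_of_list (concat (map (\<lambda>A. list_of_vec (A *\<^sub>v vec_mat Y)) ?As))"
    unfolding perm_P_def using foldr_append_rows_mult_vec[OF carr v] by blast
  also have "map (\<lambda>A. list_of_vec (A *\<^sub>v vec_mat Y)) ?As = map list_of_vec (rows Y)"
    using Y by (simp add: rows_def kronecker_unit_row_mult_vec_mat)
  finally show ?thesis by (simp add: vec_mat_def)
qed

text \<open>A unit of the matrix ring cannot make \<open>mat_inverse\<close> return
  \<open>None\<close>, so \<open>the\<close> yields a genuine inverse.\<close>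

lemma matinv_props:
  assumes A: "A \<in> carrier_mat n n" and inv: "invertible_mat A"
  shows "matinv A \<in> carrier_mat n n" and "matinv A * A = 1\<^sub>m n" and "A * matinv A = 1\<^sub>m n"
proof -
  obtain B where AB: "A * B = 1\<^sub>m n" and BA': "B * A = 1\<^sub>m (dim_row B)"
    using inv A by (auto simp: invertible_mat_def inverts_mat_def)
  \<comment> \<open>The witness comes without dimensions; comparing column counts in the two
    products makes it square of size \<open>n\<close>.\<close>
  have B: "B \<in> carrier_mat n n"
    using arg_cong[OF AB, of dim_col] arg_cong[OF BA', of dim_col] A by auto
  then have BA: "B * A = 1\<^sub>m n" using BA' by simp
  have "A \<in> Units (ring_mat TYPE('a) n ())"
    using A B AB BA by (auto simp: Units_def ring_mat_simps)
  then obtain A' where A': "mat_inverse A = Some A'"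
    using mat_inverse(1)[OF A, of "()"] by (cases "mat_inverse A") auto
  show "matinv A \<in> carrier_mat n n" "matinv A * A = 1\<^sub>m n" "A * matinv A = 1\<^sub>m n"
    using mat_inverse(2)[OF A A'] A' by (auto simp: matinv_def)
qed

theorem theorem3p1:
  fixes A B C X :: "real mat" and n :: nat
  assumes "A \<in> carrier_mat n n" and "B \<in> carrier_mat n n"
    and "C \<in> carrier_mat n n" and "X \<in> carrier_mat n n"
    and "invertible_mat A"
    and "A * X + X\<^sup>T * B = C"
  shows "let X' = A * X;
             M = B\<^sup>T * matinv A;
             Q = C - vec_mat_inv n (perm_P n *\<^sub>v vec_mat (M * C))
         in X' - M * X' * M\<^sup>T = Q"
proof -
  note A = assms(1) and B = assms(2) and C = assms(3) and X = assms(4)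
  define M where "M = B\<^sup>T * matinv A"
  note inv = matinv_props[OF A assms(5)]
  have M: "M \<in> carrier_mat n n" using B inv(1) by (simp add: M_def)
  have MA: "M * A = B\<^sup>T"
    using A B inv by (simp add: M_def assoc_mult_mat[of _ n n _ n _ n])
  \<comment> \<open>The transpose of \<open>MA\<close>; it serves to rewrite
    \<open>X\<^sup>T * B\<close> in terms of \<open>(A * X)\<^sup>T\<close>.\<close>
  have B_eq: "B = A\<^sup>T * M\<^sup>T"
    using transpose_mult[OF M A] MA by simp
  have AX: "A * X \<in> carrier_mat n n" and XB: "X\<^sup>T * B \<in> carrier_mat n n"
    and MAX: "M * (A * X) \<in> carrier_mat n n" and MXB: "M * (X\<^sup>T * B) \<in> carrier_mat n n"
    and MAXM: "M * (A * X) * M\<^sup>T \<in> carrier_mat n n"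
    using A B X M by auto
  have "X\<^sup>T * B = (A * X)\<^sup>T * M\<^sup>T"
    using A X M by (simp add: B_eq transpose_mult[OF A X] assoc_mult_mat[of _ n n _ n _ n])
  then have "(X\<^sup>T * B)\<^sup>T = M * (A * X)"
    using transpose_mult[of "(A * X)\<^sup>T" n n "M\<^sup>T" n] AX M by simp
  then have tr: "(M * (X\<^sup>T * B))\<^sup>T = M * (A * X) * M\<^sup>T"
    using transpose_mult[OF M XB] by simp
  have "M * (A * X) = B\<^sup>T * X"
    using MA A X M by (simp flip: assoc_mult_mat[of _ n n _ n _ n])
  then have tr': "(M * (A * X))\<^sup>T = X\<^sup>T * B"
    using transpose_mult[of "B\<^sup>T" n n X n] B X by simp
  \<comment> \<open>Matrices of all sizes share one type, so cancellation is restricted to the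
    carrier and checked entrywise.\<close>
  have cancel: "U + V - (V + W) = U - W"
    if "U \<in> carrier_mat n n" "V \<in> carrier_mat n n" "W \<in> carrier_mat n n" for U V W :: "real mat"
    using that by (intro eq_matI) auto
  have "(M * C)\<^sup>T = X\<^sup>T * B + M * (A * X) * M\<^sup>T"
    unfolding assms(6)[symmetric] mult_add_distrib_mat[OF M AX XB] transpose_add[OF MAX MXB] tr tr' ..
  moreover have "A * X + X\<^sup>T * B - (X\<^sup>T * B + M * (A * X) * M\<^sup>T) = A * X - M * (A * X) * M\<^sup>T"
    by (rule cancel[OF AX XB MAXM])
  ultimately have "A * X - M * (A * X) * M\<^sup>T = C - (M * C)\<^sup>T"
    using assms(6) by simp
  moreover have "vec_mat_inv n (perm_P n *\<^sub>v vec_mat (M * C)) = (M * C)\<^sup>T"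
    using M C by (simp add: perm_P_mult_vec_mat[of _ n] vec_mat_inv_vec_mat)
  ultimately show ?thesis by (simp add: Let_def M_def)
qed

end
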